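(* Let $A$ be an arbitrary C*-algebra and $\{\mathcal F,\langle\cdot,\cdot\rangle\}$ be a Hilbert $A$-module. Let $B$ be another C*-algebra that admits a $*$-representation in $\mathrm{End}_A^*(\mathcal F)$, so that $\mathcal F$ is a Hilbert $A$-$B$-bimodule. Then $\mathcal F$ is a projective object in the category $\mathcal B^*(A,B)$.
   Context: Hilbert $A$-modules are left $A$-modules with an $A$-valued inner product that is $A$-linear in the first argument, complete in the norm $\|x\|=\|\langle x,x\rangle\|^{1/2}$. $\mathrm{End}_A^*(\mathcal F)$ is the C*-algebra of adjointable bounded $A$-linear operators on $\mathcal F$. A Hilbert $A$-$B$-bimodule is a Hilbert $A$-module $\mathcal M$ together with a right action of the C*-algebra $B$ by bounded adjointable $A$-linear maps given by a $*$-representation, so that $\langle a m_1 b,m_2\rangle=a\langle m_1,m_2b^*\rangle$. $\mathcal B^*(A,B)$ is the category whose objects are Hilbert $A$-$B$-bimodules and whose morphisms are the adjointable bounded $A$-$B$-bimodule maps. An object $\mathcal F$ is projective in $\mathcal B^*(A,B)$ if for all Hilbert $A$-$B$-bimodules $\mathcal M,\mathcal N$, every surjective adjointable bounded bimodule map $T:\mathcal N\to\mathcal M$ and every adjointable bounded bimodule map $\phi:\mathcal F\to\mathcal M$, there is an adjointable bounded bimodule map $\psi:\mathcal F\to\mathcal N$ with $T\circ\psi=\phi$. *)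

theory Defs
  imports "HOL-Analysis.Analysis"
begin

section \<open>Complex Banach spaces and C*-algebras\<close>

class complex_banach = banach +
  fixes scaleC :: "complex \<Rightarrow> 'a \<Rightarrow> 'a"  (infixr \<open>*\<^sub>C\<close> 75)
  assumes scaleC_add_right: "c *\<^sub>C (x + y) = c *\<^sub>C x + c *\<^sub>C y"
    and scaleC_add_left: "(c + d) *\<^sub>C x = c *\<^sub>C x + d *\<^sub>C x"
    and scaleC_scaleC: "c *\<^sub>C d *\<^sub>C x = (c * d) *\<^sub>C x"
    and scaleC_of_real: "complex_of_real r *\<^sub>C x = r *\<^sub>R x"
    and norm_scaleC: "norm (c *\<^sub>C x) = cmod c * norm x"

text \<open>No unit is required: \<^class>\<open>real_normed_algebra\<close> is the non-unital class.\<close>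

class cstar_algebra = complex_banach + real_normed_algebra +
  fixes star :: "'a \<Rightarrow> 'a"
  assumes scaleC_mult_left: "(c *\<^sub>C x) * y = c *\<^sub>C (x * y)"
    and scaleC_mult_right: "x * (c *\<^sub>C y) = c *\<^sub>C (x * y)"
    and star_add: "star (x + y) = star x + star y"
    and star_scaleC: "star (c *\<^sub>C x) = cnj c *\<^sub>C star x"
    and star_mult: "star (x * y) = star y * star x"
    and star_star: "star (star x) = x"
    and cstar_identity: "norm (star x * x) = (norm x)\<^sup>2"

definition positive_element :: "'a::cstar_algebra \<Rightarrow> bool" where
  "positive_element a \<longleftrightarrow> (\<exists>b. a = star b * b)"

section \<open>Hilbert modules\<close>

record ('a, 'm) hilbert_module =
  lact :: "'a \<Rightarrow> 'm \<Rightarrow> 'm"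
  ip :: "'m \<Rightarrow> 'm \<Rightarrow> 'a"

text \<open>
  The underlying complex vector space of a module is the whole type \<open>'m\<close>. Its norm comes from
  the class \<^class>\<open>complex_banach\<close>, which also supplies completeness; the last assumption
  forces it to be the norm induced by the inner product.
\<close>

locale hilbert_module =
  fixes F :: "('a::cstar_algebra, 'm::complex_banach, 'z) hilbert_module_scheme"
  assumes lact_add_right: "lact F a (x + y) = lact F a x + lact F a y"
    and lact_add_left: "lact F (a + b) x = lact F a x + lact F b x"
    and lact_mult: "lact F (a * b) x = lact F a (lact F b x)"
    and lact_scaleC_left: "lact F (c *\<^sub>C a) x = c *\<^sub>C lact F a x"
    and lact_scaleC_right: "lact F a (c *\<^sub>C x) = c *\<^sub>C lact F a x"
    and ip_add_left: "ip F (x + y) z = ip F x z + ip F y z"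
    and ip_scaleC_left: "ip F (c *\<^sub>C x) y = c *\<^sub>C ip F x y"
    and ip_lact_left: "ip F (lact F a x) y = a * ip F x y"
    and star_ip: "star (ip F x y) = ip F y x"
    and ip_positive: "positive_element (ip F x x)"
    and ip_definite: "ip F x x = 0 \<Longrightarrow> x = 0"
    and norm_eq_sqrt_ip: "norm x = sqrt (norm (ip F x x))"

definition is_adjoint ::
  "('a, 'm, 'y) hilbert_module_scheme \<Rightarrow> ('a, 'n, 'z) hilbert_module_scheme
    \<Rightarrow> ('m \<Rightarrow> 'n) \<Rightarrow> ('n \<Rightarrow> 'm) \<Rightarrow> bool" where
  "is_adjoint M N T S \<longleftrightarrow> (\<forall>x y. ip N (T x) y = ip M x (S y))"

text \<open>Adjointable bounded \<open>A\<close>-linear maps from \<open>M\<close> to \<open>N\<close>; \<open>End\<^sub>A\<^sup>*(F)\<close> is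
  \<open>adjointable_maps F F\<close>.\<close>

definition adjointable_maps ::
  "('a::cstar_algebra, 'm::complex_banach, 'y) hilbert_module_scheme
    \<Rightarrow> ('a, 'n::complex_banach, 'z) hilbert_module_scheme \<Rightarrow> ('m \<Rightarrow> 'n) set" where
  "adjointable_maps M N =
    {T. bounded_linear T \<and> (\<forall>c x. T (c *\<^sub>C x) = c *\<^sub>C T x)
      \<and> (\<forall>a x. T (lact M a x) = lact N a (T x))
      \<and> (\<exists>S. is_adjoint M N T S)}"

section \<open>Hilbert bimodules\<close>

text \<open>
  Operators of the representation act on the right of the left module \<open>F\<close>, so the product
  \<open>b c\<close> acts by first \<open>\<pi> b\<close> and then \<open>\<pi> c\<close>. Representations may be degenerate.
\<close>

definition star_representation ::
  "('a::cstar_algebra, 'm::complex_banach, 'z) hilbert_module_scheme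
    \<Rightarrow> ('b::cstar_algebra \<Rightarrow> 'm \<Rightarrow> 'm) \<Rightarrow> bool" where
  "star_representation F \<pi> \<longleftrightarrow>
    (\<forall>b. \<pi> b \<in> adjointable_maps F F)
    \<and> (\<forall>b c x. \<pi> (b + c) x = \<pi> b x + \<pi> c x)
    \<and> (\<forall>k b x. \<pi> (k *\<^sub>C b) x = k *\<^sub>C \<pi> b x)
    \<and> (\<forall>b c x. \<pi> (b * c) x = \<pi> c (\<pi> b x))
    \<and> (\<forall>b. is_adjoint F F (\<pi> b) (\<pi> (star b)))"

record ('a, 'b, 'm) hilbert_bimodule = "('a, 'm) hilbert_module" +
  ract :: "'m \<Rightarrow> 'b \<Rightarrow> 'm"

definition hilbert_bimodule ::
  "('a::cstar_algebra, 'b::cstar_algebra, 'm::complex_banach) hilbert_bimodule \<Rightarrow> bool" where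
  "hilbert_bimodule M \<longleftrightarrow> hilbert_module M \<and> star_representation M (\<lambda>b x. ract M x b)"

definition with_right_action ::
  "('a, 'm) hilbert_module \<Rightarrow> ('b \<Rightarrow> 'm \<Rightarrow> 'm) \<Rightarrow> ('a, 'b, 'm) hilbert_bimodule" where
  "with_right_action F \<pi> = \<lparr>lact = lact F, ip = ip F, ract = (\<lambda>x b. \<pi> b x)\<rparr>"

definition bimodule_maps ::
  "('a::cstar_algebra, 'b::cstar_algebra, 'm::complex_banach) hilbert_bimodule
    \<Rightarrow> ('a, 'b, 'n::complex_banach) hilbert_bimodule \<Rightarrow> ('m \<Rightarrow> 'n) set" where
  "bimodule_maps M N =
    {T \<in> adjointable_maps M N. \<forall>x b. T (ract M x b) = ract N (T x) b}"

text \<open>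
  HOL cannot quantify over types inside a formula, so the types carrying the test objects
  \<open>M\<close> and \<open>N\<close> are arguments. A theorem in which \<open>'m\<close> and \<open>'n\<close> are type variables covers
  all Hilbert \<open>A\<close>-\<open>B\<close>-bimodules \<open>M\<close> and \<open>N\<close>.
\<close>

definition projective_object ::
  "'m::complex_banach itself \<Rightarrow> 'n::complex_banach itself
    \<Rightarrow> ('a::cstar_algebra, 'b::cstar_algebra, 'f::complex_banach) hilbert_bimodule \<Rightarrow> bool" where
  "projective_object _ _ F \<longleftrightarrow> hilbert_bimodule F \<and>
    (\<forall>(M :: ('a, 'b, 'm) hilbert_bimodule) (N :: ('a, 'b, 'n) hilbert_bimodule).
      hilbert_bimodule M \<longrightarrow> hilbert_bimodule N \<longrightarrow>
      (\<forall>T \<in> bimodule_maps N M. \<forall>\<phi> \<in> bimodule_maps F M.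
        surj T \<longrightarrow> (\<exists>\<psi> \<in> bimodule_maps F N. T \<circ> \<psi> = \<phi>)))"

end

(* A surjective adjointable T : N -> M has an adjointable bimodule right inverse, namely
   T* (T T* )^-1, and composing it with phi lifts phi. By the Baire category theorem
   T* is bounded below, so the self-adjoint operator P = T T* satisfies
   |<P y, y>| = |T* y|^2 >= d^2 |y|^2. Since the self-adjoint part of <(P + i t) y, y>
   is <P y, y>, all the operators P + i t with t real are bounded below uniformly in t; they
   are onto for large t by a Neumann series argument, hence also for t = 0 by the
   continuity method. *)

theory Submission
  imports Defs
begin

section \<open>Scalars and norms in C*-algebras\<close>

lemma scaleC_zero_right [simp]: "c *\<^sub>C (0::'a::complex_banach) = 0"
  using scaleC_add_right[of c 0 0] by simp

lemma scaleC_minus_right: "c *\<^sub>C (- x) = - (c *\<^sub>C (x::'a::complex_banach))"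
  using scaleC_add_right[of c x "- x"] by (simp add: eq_neg_iff_add_eq_0 add.commute)

lemma scaleC_diff_right: "c *\<^sub>C (x - y) = c *\<^sub>C x - c *\<^sub>C (y::'a::complex_banach)"
  using scaleC_add_right[of c x "- y"] by (simp add: scaleC_minus_right)

lemma scaleC_diff_left: "(c - d) *\<^sub>C x = c *\<^sub>C x - d *\<^sub>C (x::'a::complex_banach)"
  using scaleC_add_left[of "c - d" d x] by simp

lemma scaleC_one [simp]: "1 *\<^sub>C (x::'a::complex_banach) = x"
  using scaleC_of_real[of 1 x] by simp

lemma scaleC_zero_left [simp]: "0 *\<^sub>C (x::'a::complex_banach) = 0"
  using scaleC_of_real[of 0 x] by simp

lemma scaleC_uminus_one: "(- 1) *\<^sub>C (x::'a::complex_banach) = - x"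
  using scaleC_of_real[of "- 1" x] by simp

lemma norm_star [simp]: "norm (star (a::'a::cstar_algebra)) = norm a"
proof -
  have le: "norm x \<le> norm (star x)" for x :: 'a
  proof (cases "norm x = 0")
    case False
    have "norm x * norm x \<le> norm (star x) * norm x"
      using norm_mult_ineq[of "star x" x] by (simp add: cstar_identity power2_eq_square)
    then show ?thesis using False by simp
  qed simp
  show ?thesis using le[of a] le[of "star a"] by (simp add: star_star)
qed

text \<open>The element \<open>a\<close> is the self-adjoint part of \<open>z = a + i t b\<close>,
  that is \<open>2 a = z + star z\<close>, and \<open>star\<close> is isometric. The bound is
  independent of \<open>t\<close>, which the continuity method relies on.\<close>

lemma norm_self_adjoint_le_norm_add_imaginary:
  fixes a b :: "'a::cstar_algebra"
  assumes "star a = a" "star b = b"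
  shows "norm a \<le> norm (a + (\<i> * complex_of_real t) *\<^sub>C b)" (is "_ \<le> norm ?z")
proof -
  have "star ?z = a - (\<i> * complex_of_real t) *\<^sub>C b"
    using scaleC_diff_left[of 0 "\<i> * complex_of_real t" b]
    by (simp add: star_add star_scaleC assms)
  then have "2 *\<^sub>R a = ?z + star ?z" by (simp add: scaleR_2)
  then have "norm (2 *\<^sub>R a) \<le> norm ?z + norm (star ?z)" by (metis norm_triangle_ineq)
  then show ?thesis by simp
qed

section \<open>Inner product calculus\<close>

context hilbert_module
begin

lemma ip_add_right: "ip F x (y + z) = ip F x y + ip F x z"
  by (metis star_ip ip_add_left star_add)

lemma ip_scaleC_right: "ip F x (c *\<^sub>C y) = cnj c *\<^sub>C ip F x y"
  by (metis star_ip ip_scaleC_left star_scaleC)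

lemma ip_lact_right: "ip F x (lact F a y) = ip F x y * star a"
  by (metis star_ip ip_lact_left star_mult)

lemma ip_diff_left: "ip F (x - y) z = ip F x z - ip F y z"
  using ip_add_left[of "x - y" y z] by simp

lemma ip_diff_right: "ip F x (y - z) = ip F x y - ip F x z"
  using ip_add_right[of x "y - z" z] by simp

lemma norm_ip_self: "norm (ip F x x) = (norm x)\<^sup>2"
  by (simp add: norm_eq_sqrt_ip)

text \<open>Testing with \<open>x = y - z\<close> reduces this to definiteness. Identities for an
  adjoint are later verified by pairing both sides with an arbitrary vector.\<close>

lemma ip_left_ext:
  assumes "\<And>x. ip F x y = ip F x z"
  shows "y = z"
  using ip_definite[of "y - z"] assms[of "y - z"] by (simp add: ip_diff_right)

lemma ip_scaleR_left: "ip F (r *\<^sub>R x) y = r *\<^sub>R ip F x y"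
  using ip_scaleC_left[of "complex_of_real r" x y] by (simp add: scaleC_of_real)

lemma ip_scaleR_right: "ip F x (r *\<^sub>R y) = r *\<^sub>R ip F x y"
  using ip_scaleC_right[of x "complex_of_real r" y] by (simp add: scaleC_of_real)

text \<open>Diagonal values of the inner product are controlled by the norm, so this identity makes
  the off-diagonal ones accessible. The sign of the \<open>\<i>\<close> term fits a form that is
  conjugate linear in the second argument.\<close>

lemma polarization:
  "4 *\<^sub>R ip F x y = ip F (x + y) (x + y) - ip F (x - y) (x - y)
    + \<i> *\<^sub>C (ip F (x + \<i> *\<^sub>C y) (x + \<i> *\<^sub>C y) - ip F (x - \<i> *\<^sub>C y) (x - \<i> *\<^sub>C y))"
proof -
  have "4 *\<^sub>R ip F x y = ip F x y + ip F x y + (ip F x y + ip F x y)"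
    using scaleR_2[of "ip F x y"] scaleR_add_left[of 2 2 "ip F x y"] by simp
  then show ?thesis
    by (simp add: ip_add_left ip_add_right ip_diff_left ip_diff_right ip_scaleC_left
        ip_scaleC_right scaleC_add_right scaleC_diff_right scaleC_minus_right scaleC_scaleC
        scaleC_uminus_one)
qed

text \<open>The constant 4 comes from polarization; the Cauchy--Schwarz constant 1 would need the
  order structure of the C*-algebra.\<close>

lemma norm_ip_le: "norm (ip F x y) \<le> 4 * norm x * norm y"
proof (cases "x = 0 \<or> y = 0")
  case True
  then show ?thesis using ip_scaleR_left[of 0 x y] ip_scaleR_right[of x 0 y] by auto
next
  case False
  \<comment> \<open>After normalising, the four vectors \<open>u \<plusminus> v\<close> and
    \<open>u \<plusminus> \<i> v\<close> have norm at most 2. Each diagonal term is then at most 4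
    in norm, and their sum at most 16.\<close>
  define u where "u = x /\<^sub>R norm x"
  define v where "v = y /\<^sub>R norm y"
  have u: "norm u = 1" and v: "norm v = 1" using False by (auto simp: u_def v_def)
  have q: "norm (ip F z z) \<le> 4" if "norm z \<le> 2" for z
    using power_mono[OF that, of 2] by (simp add: norm_ip_self)
  have v': "norm (\<i> *\<^sub>C v) = 1" using v by (simp add: norm_scaleC)
  have b: "norm (ip F (u + w) (u + w)) \<le> 4" "norm (ip F (u - w) (u - w)) \<le> 4"
    if "norm w = 1" for w
    using q[of "u + w"] q[of "u - w"] norm_triangle_ineq[of u w] norm_triangle_ineq4[of u w] u that
    by auto
  have "norm (4 *\<^sub>R ip F u v) \<le> 16"
    unfolding polarization
    using b[OF v] b[OF v']
      norm_triangle_ineq4[of "ip F (u + v) (u + v)" "ip F (u - v) (u - v)"]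
      norm_triangle_ineq4[of "ip F (u + \<i> *\<^sub>C v) (u + \<i> *\<^sub>C v)" "ip F (u - \<i> *\<^sub>C v) (u - \<i> *\<^sub>C v)"]
    by (intro order_trans[OF norm_triangle_ineq]) (simp add: norm_scaleC)
  then have "norm (ip F u v) \<le> 4" by simp
  moreover have "ip F x y = (norm x * norm y) *\<^sub>R ip F u v"
    using False by (simp add: u_def v_def ip_scaleR_left ip_scaleR_right field_simps)
  ultimately show ?thesis
    using mult_left_mono[of "norm (ip F u v)" 4 "norm x * norm y"] by (simp add: mult_ac)
qed

text \<open>This supplies the continuity that makes the sets of the Baire argument closed.\<close>

lemma bounded_linear_ip_left: "bounded_linear (\<lambda>x. ip F x y)"
  by (rule bounded_linear_intro[where K = "4 * norm y"])
    (use norm_ip_le in \<open>auto simp: ip_add_left ip_scaleR_left mult_ac\<close>)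

end

section \<open>Adjoints and composition of bimodule maps\<close>

lemma is_adjoint_sym:
  assumes "hilbert_module M" "hilbert_module N" "is_adjoint M N T S"
  shows "is_adjoint N M S T"
  using assms unfolding is_adjoint_def by (metis hilbert_module.star_ip)

text \<open>Pairing with an arbitrary vector moves every algebraic identity for \<open>S\<close>
  across to the second slot of \<open>ip N\<close>. Boundedness follows from |S y|^2 = |<T (S y),
  y>| after cancelling |S y|.\<close>

lemma adjoint_in_adjointable_maps:
  assumes M: "hilbert_module M" and N: "hilbert_module N"
    and T: "T \<in> adjointable_maps M N" and adj: "is_adjoint M N T S"
  shows "S \<in> adjointable_maps N M"
proof -
  interpret M: hilbert_module M by (rule M)
  interpret N: hilbert_module N by (rule N)
  have T': "bounded_linear T" using T by (simp add: adjointable_maps_def)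
  have TS: "ip M x (S y) = ip N (T x) y" for x y using adj by (simp add: is_adjoint_def)
  have add: "S (x + y) = S x + S y" for x y
    by (rule M.ip_left_ext) (simp add: TS M.ip_add_right N.ip_add_right)
  have sc: "S (c *\<^sub>C x) = c *\<^sub>C S x" for c x
    by (rule M.ip_left_ext) (simp add: TS M.ip_scaleC_right N.ip_scaleC_right)
  have la: "S (lact N a x) = lact M a (S x)" for a x
    by (rule M.ip_left_ext) (simp add: TS M.ip_lact_right N.ip_lact_right)
  obtain K where K: "K > 0" "\<And>x. norm (T x) \<le> norm x * K"
    using bounded_linear.pos_bounded[OF T'] by blast
  have "norm (S y) \<le> norm y * (4 * K)" for y
  proof (cases "S y = 0")
    case False
    have "norm (S y) * norm (S y) = norm (ip N (T (S y)) y)"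
      by (simp add: TS[symmetric] M.norm_ip_self power2_eq_square)
    also have "\<dots> \<le> 4 * norm (T (S y)) * norm y" by (rule N.norm_ip_le)
    also have "\<dots> \<le> 4 * (norm (S y) * K) * norm y"
      by (intro mult_right_mono mult_left_mono K) auto
    finally have "norm (S y) * norm (S y) \<le> norm (S y) * (norm y * (4 * K))"
      by (simp add: mult_ac)
    then show ?thesis using False by simp
  qed (use K in auto)
  then have "bounded_linear S"
    by (intro bounded_linear_intro[of S "4 * K"])
      (use sc[of "complex_of_real _"] in \<open>auto simp: add scaleC_of_real\<close>)
  then show ?thesis
    unfolding adjointable_maps_def using sc la is_adjoint_sym[OF M N adj] by blast
qed

lemma adjointable_maps_comp:
  assumes "T \<in> adjointable_maps M N" "U \<in> adjointable_maps N L"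
  shows "U \<circ> T \<in> adjointable_maps M L"
proof -
  obtain S V where "is_adjoint M N T S" "is_adjoint N L U V"
    using assms by (auto simp: adjointable_maps_def)
  then have "is_adjoint M L (U \<circ> T) (S \<circ> V)" by (simp add: is_adjoint_def)
  then show ?thesis
    using assms bounded_linear_compose[of U T] by (auto simp: adjointable_maps_def comp_def)
qed

lemma bimodule_maps_comp:
  assumes "T \<in> bimodule_maps M N" "U \<in> bimodule_maps N L"
  shows "U \<circ> T \<in> bimodule_maps M L"
  using assms adjointable_maps_comp[of T M N U L] by (simp add: bimodule_maps_def)

lemma ip_ract_right:
  assumes "hilbert_bimodule M"
  shows "ip M x (ract M y b) = ip M (ract M x (star b)) y"
proof -
  have "is_adjoint M M (\<lambda>x. ract M x (star b)) (\<lambda>x. ract M x (star (star b)))"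
    using assms by (simp add: hilbert_bimodule_def star_representation_def)
  then show ?thesis by (simp add: is_adjoint_def star_star)
qed

text \<open>In an inner product, the action of \<open>b\<close> on one side becomes that of
  \<open>star b\<close> on the other, and \<open>T\<close> commutes with the latter.\<close>

lemma adjoint_in_bimodule_maps:
  assumes M: "hilbert_bimodule M" and N: "hilbert_bimodule N"
    and T: "T \<in> bimodule_maps M N" and adj: "is_adjoint M N T S"
  shows "S \<in> bimodule_maps N M"
proof -
  have hm: "hilbert_module M" "hilbert_module N"
    using M N by (simp_all add: hilbert_bimodule_def)
  have "S (ract N y b) = ract M (S y) b" for y b
  proof (rule hilbert_module.ip_left_ext[OF hm(1)])
    fix x
    have "ip M x (S z) = ip N (T x) z" for x z using adj by (simp add: is_adjoint_def)
    then show "ip M x (S (ract N y b)) = ip M x (ract M (S y) b)"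
      using T by (simp add: ip_ract_right[OF M] ip_ract_right[OF N] bimodule_maps_def)
  qed
  then show ?thesis
    using adjoint_in_adjointable_maps[OF hm _ adj] T by (simp add: bimodule_maps_def)
qed

section \<open>Surjectivity under small perturbations\<close>

text \<open>With a right inverse \<open>G\<close> of \<open>Q\<close>, solutions of
  \<open>Q x + R x = y\<close> arise as fixed points of \<open>x \<mapsto> G (y - R x)\<close>. The
  lower bound on \<open>Q\<close> makes this map Lipschitz with constant
  \<open>c / d < 1\<close>.\<close>

lemma surj_perturb:
  fixes Q R :: "'a::banach \<Rightarrow> 'a"
  assumes Q: "linear Q" "surj Q" "\<And>x. d * norm x \<le> norm (Q x)" "d > 0"
    and R: "linear R" "\<And>x. norm (R x) \<le> c * norm x" "0 \<le> c" "c < d"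
  shows "surj (\<lambda>x. Q x + R x)"
proof -
  have "\<exists>x. Q x + R x = y" for y
  proof -
    define G where "G = inv Q"
    have QG: "Q (G z) = z" for z unfolding G_def by (simp add: surj_f_inv_f Q)
    have "dist (G (y - R x)) (G (y - R x')) \<le> c / d * dist x x'" for x x'
    proof -
      have "Q (G (y - R x) - G (y - R x')) = R (x' - x)"
        by (simp add: linear_diff[OF Q(1)] linear_diff[OF R(1)] QG)
      then have "d * norm (G (y - R x) - G (y - R x')) \<le> c * norm (x' - x)"
        using Q(3) R(2) by (metis order_trans)
      then show ?thesis using Q(4) by (simp add: dist_norm field_simps norm_minus_commute)
    qed
    then obtain x where "G (y - R x) = x"
      using banach_fix_type[of "c / d" "\<lambda>x. G (y - R x)"] R Q by auto
    then have "Q x + R x = y" using QG[of "y - R x"] by (simp add: algebra_simps)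
    then show ?thesis by blast
  qed
  then show ?thesis unfolding surj_def by metis
qed

section \<open>Lower bound for the adjoint of a surjection\<close>

text \<open>This is a uniform boundedness argument: for \<open>m = T x\<close> the pairing with
  \<open>y\<close> equals <x, S y>, hence is bounded over all \<open>y\<close> with
  \<open>norm (S y) \<le> 1\<close>. By Baire the bound is uniform on some ball of vectors
  \<open>m\<close>, and this bounds \<open>y\<close> itself.\<close>

lemma adjoint_bounded_below_if_surj:
  assumes M: "hilbert_module M" and N: "hilbert_module N"
    and T: "T \<in> adjointable_maps N M" "surj T" and adj: "is_adjoint N M T S"
  obtains d where "d > 0" "\<And>y. d * norm y \<le> norm (S y)"
proof -
  interpret M: hilbert_module M by (rule M)
  interpret N: hilbert_module N by (rule N)
  have TS: "ip M (T x) y = ip N x (S y)" for x y using adj by (simp add: is_adjoint_def)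
  have linS: "linear S"
    using adjoint_in_adjointable_maps[OF N M T(1) adj]
    by (simp add: adjointable_maps_def bounded_linear.linear)
  define V where "V k = (\<Inter>y\<in>{y. norm (S y) \<le> 1}. {m. norm (ip M m y) \<le> real k})" for k
  have closed: "closed (V k)" for k
    unfolding V_def
    by (intro closed_INT ballI closed_Collect_le continuous_intros
        linear_continuous_on M.bounded_linear_ip_left)
  have cover: "(\<Union>k. V k) = UNIV"
  proof -
    have "\<exists>k. m \<in> V k" for m
    proof -
      obtain x where x: "m = T x" using T(2) by (meson surjD)
      obtain k where k: "4 * norm x \<le> real k" using real_arch_simple by blast
      have "norm (ip M m y) \<le> real k" if "norm (S y) \<le> 1" for y
      proof -
        have "norm (ip M m y) \<le> 4 * norm x * norm (S y)" by (simp add: x TS N.norm_ip_le)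
        also have "\<dots> \<le> 4 * norm x * 1" using that by (intro mult_left_mono) auto
        finally show ?thesis using k by simp
      qed
      then show ?thesis by (auto simp: V_def)
    qed
    then show ?thesis by auto
  qed
  have "\<exists>k. interior (V k) \<noteq> {}"
  proof (rule ccontr)
    assume "\<not> ?thesis"
    then have "euclidean interior_of \<Union>(range V) = {}"
      by (intro Baire_category_alt)
        (auto simp: completely_metrizable_space_euclidean closed simp flip: closed_closedin)
    then show False using cover by simp
  qed
  then obtain k m r where r: "r > 0" and ball: "ball m r \<subseteq> V k"
    by (metis ex_in_conv mem_interior)
  have bound: "norm y \<le> 4 * real k / r" if "norm (S y) \<le> 1" for y
  proof (cases "y = 0")
    case False
    \<comment> \<open>The multiple of \<open>y\<close> of norm \<open>r / 2\<close>:
      \<open>m + w\<close> stays in the ball, while pairing \<open>w\<close> with \<open>y\<close>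
      recovers the norm of \<open>y\<close>.\<close>
    define w where "w = (r / 2 / norm y) *\<^sub>R y"
    have "m \<in> V k" "m + w \<in> V k" using ball r False by (auto simp: w_def dist_norm)
    then have "norm (ip M m y) \<le> real k" "norm (ip M (m + w) y) \<le> real k"
      using that by (auto simp: V_def)
    moreover have "ip M w y = ip M (m + w) y - ip M m y" by (simp add: M.ip_add_left)
    ultimately have "norm (ip M w y) \<le> 2 * real k"
      using norm_triangle_ineq4[of "ip M (m + w) y" "ip M m y"] by simp
    moreover have "norm (ip M w y) = r / 2 * norm y"
      using r False by (simp add: w_def M.ip_scaleR_left M.norm_ip_self power2_eq_square)
    ultimately show ?thesis using r by (simp add: field_simps)
  qed (use r in auto)
  \<comment> \<open>The summand 1 keeps \<open>C\<close> positive when \<open>k = 0\<close>, so that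
    \<open>1 / C\<close> can serve as the lower bound.\<close>
  define C where "C = 4 * real k / r + 1"
  have C: "C > 0" using r by (simp add: C_def add_nonneg_pos)
  have "norm y \<le> C * norm (S y)" for y
  proof (cases "S y = 0")
    case True
    \<comment> \<open>Here \<open>y\<close> cannot be rescaled by the norm of \<open>S y\<close>;
      instead surjectivity of \<open>T\<close> forces \<open>y = 0\<close>.\<close>
    obtain x where "y = T x" using T(2) by (meson surjD)
    then have "ip M y y = ip N x (S y)" by (metis TS)
    then have "norm (ip M y y) = 0" using N.norm_ip_le[of x "S y"] True by simp
    then show ?thesis using C by (simp add: M.norm_ip_self)
  next
    case False
    have "norm (y /\<^sub>R norm (S y)) \<le> 4 * real k / r"
      by (rule bound) (simp add: linear_scale[OF linS] False)
    also have "\<dots> \<le> C" by (simp add: C_def)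
    finally show ?thesis using False by (simp add: field_simps)
  qed
  then show ?thesis using C by (intro that[of "1 / C"]) (auto simp: field_simps)
qed

section \<open>The continuity method for self-adjoint operators\<close>

lemma surj_if_self_adjoint_bounded_below:
  assumes M: "hilbert_module M" and P: "P \<in> adjointable_maps M M" and adj: "is_adjoint M M P P"
    and e: "e > 0" "\<And>y. e * (norm y)\<^sup>2 \<le> norm (ip M (P y) y)"
  shows "surj P"
proof -
  interpret hilbert_module M by (rule M)
  have bl: "bounded_linear P" using P by (simp add: adjointable_maps_def)
  note P_linear = bounded_linear.linear[OF bl]
  have lin: "linear (\<lambda>x. c *\<^sub>C x)" for c :: complex
    by (rule linearI) (simp_all add: scaleC_add_right scaleC_scaleC mult.commute flip: scaleC_of_real)
  define Q where "Q t x = P x + (\<i> * complex_of_real t) *\<^sub>C x" for t x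
  have linQ: "linear (Q t)" for t
    unfolding Q_def by (intro linear_compose_add P_linear lin)
  have sa: "star (ip M (P y) y) = ip M (P y) y" for y
    using adj unfolding is_adjoint_def by (metis star_ip)
  \<comment> \<open>The bound is uniform in \<open>t\<close> because <P y, y> is the self-adjoint
    part of <Q t y, y>. The factor 4 is the constant of \<open>norm_ip_le\<close>.\<close>
  have below: "e / 4 * norm y \<le> norm (Q t y)" for t y
  proof (cases "y = 0")
    case False
    have "e * (norm y)\<^sup>2 \<le> norm (ip M (P y) y)" by (rule e)
    also have "\<dots> \<le> norm (ip M (Q t y) y)"
      unfolding Q_def ip_add_left ip_scaleC_left
      by (rule norm_self_adjoint_le_norm_add_imaginary[OF sa star_ip])
    also have "\<dots> \<le> 4 * norm (Q t y) * norm y" by (rule norm_ip_le)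
    finally have "(e * norm y) * norm y \<le> (4 * norm (Q t y)) * norm y"
      by (simp add: power2_eq_square mult_ac)
    then show ?thesis using False by simp
  qed simp
  have step: "surj (Q s)" if "surj (Q t)" "\<bar>s - t\<bar> < e / 4" for s t
  proof -
    have "Q s = (\<lambda>x. Q t x + (\<i> * complex_of_real (s - t)) *\<^sub>C x)"
      by (auto simp: Q_def add.assoc right_diff_distrib scaleC_diff_left)
    moreover have "surj \<dots>"
      by (rule surj_perturb[OF linQ that(1) below, where c = "\<bar>s - t\<bar>"])
        (use e that lin in \<open>auto simp: norm_scaleC norm_mult simp flip: of_real_diff\<close>)
    ultimately show ?thesis by simp
  qed
  obtain K where K: "K > 0" "\<And>x. norm (P x) \<le> norm x * K"
    using bounded_linear.pos_bounded[OF bl] by blast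
  \<comment> \<open>For \<open>t > K\<close> the roles are exchanged: multiplication by
    \<open>i t\<close> is the invertible operator, and \<open>P\<close> is the small
    perturbation.\<close>
  have large: "surj (Q t)" if "t > K" for t
  proof -
    have nz: "\<i> * complex_of_real t \<noteq> 0" using that K by simp
    have "surj (\<lambda>x::'b. (\<i> * complex_of_real t) *\<^sub>C x)"
      by (rule surjI[where f = "\<lambda>x. inverse (\<i> * complex_of_real t) *\<^sub>C x"])
        (simp add: scaleC_scaleC right_inverse[OF nz] del: inverse_mult_distrib)
    then have "surj (\<lambda>x. (\<i> * complex_of_real t) *\<^sub>C x + P x)"
      by (rule surj_perturb[where d = t and c = K, OF lin])
        (use that K P_linear in \<open>auto simp: norm_scaleC norm_mult mult.commute\<close>)
    then show ?thesis by (simp add: Q_def[abs_def] add.commute)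
  qed
  \<comment> \<open>Steps of length \<open>e / 8\<close> stay strictly below the radius
    \<open>e / 4\<close> allowed by \<open>step\<close>.\<close>
  have down: "surj (Q (real n * (e / 8))) \<Longrightarrow> surj (Q 0)" for n
  proof (induction n)
    case (Suc n)
    then show ?case using step[of "real (Suc n) * (e / 8)" "real n * (e / 8)"] e
      by (auto simp: algebra_simps)
  qed simp
  obtain n where "real n * (e / 8) > K" using reals_Archimedean3[of "e / 8"] e by auto
  then have "surj (Q 0)" using large down by blast
  then show ?thesis by (simp add: Q_def[abs_def])
qed

section \<open>Inverses and right inverses of bimodule maps\<close>

text \<open>The lower bound gives both injectivity and the operator bound \<open>1 / c\<close> for
  the inverse. The inverse is its own adjoint, as \<open>P\<close> is.\<close>

lemma inv_in_bimodule_maps: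
  assumes P: "P \<in> bimodule_maps M M" "surj P" and adj: "is_adjoint M M P P"
    and c: "c > 0" "\<And>y. c * norm y \<le> norm (P y)"
  shows "inv P \<in> bimodule_maps M M"
proof -
  have bl: "bounded_linear P" using P by (simp add: bimodule_maps_def adjointable_maps_def)
  have "inj P"
  proof (rule injI)
    fix x y assume "P x = P y"
    then have "c * norm (x - y) \<le> 0"
      using c(2)[of "x - y"] by (simp add: linear_diff[OF bounded_linear.linear[OF bl]])
    then show "x = y" using c(1) by (simp add: mult_le_0_iff)
  qed
  note [simp] = surj_f_inv_f[OF P(2)] inv_f_f[OF \<open>inj P\<close>]
  \<comment> \<open>Each identity for \<open>inv P\<close> is reduced to the corresponding one for
    \<open>P\<close>.\<close>
  have eqI: "inv P z = w" if "z = P w" for z w using that by simp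
  have sc: "inv P (k *\<^sub>C x) = k *\<^sub>C inv P x" for k x
    by (rule eqI) (use P in \<open>simp add: bimodule_maps_def adjointable_maps_def\<close>)
  have "norm (inv P x) \<le> norm x * (1 / c)" for x
    using c(2)[of "inv P x"] c(1) by (simp add: field_simps)
  moreover have "inv P (x + y) = inv P x + inv P y" for x y
    by (rule eqI) (simp add: linear_add[OF bounded_linear.linear[OF bl]])
  ultimately have "bounded_linear (inv P)"
    using sc[of "complex_of_real _"] by (intro bounded_linear_intro[where K = "1 / c"]) (auto simp: scaleC_of_real)
  moreover have "inv P (lact M a x) = lact M a (inv P x)" for a x
    by (rule eqI) (use P in \<open>simp add: bimodule_maps_def adjointable_maps_def\<close>)
  moreover have "inv P (ract M x b) = ract M (inv P x) b" for x b
    by (rule eqI) (use P in \<open>simp add: bimodule_maps_def\<close>)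
  moreover have "is_adjoint M M (inv P) (inv P)"
    unfolding is_adjoint_def
  proof (intro allI)
    fix x y
    show "ip M (inv P x) y = ip M x (inv P y)"
      using adj[unfolded is_adjoint_def, rule_format, of "inv P x" "inv P y"] by simp
  qed
  ultimately show ?thesis using sc by (auto simp: bimodule_maps_def adjointable_maps_def)
qed

lemma surj_bimodule_map_right_inverse:
  assumes M: "hilbert_bimodule M" and N: "hilbert_bimodule N"
    and T: "T \<in> bimodule_maps N M" "surj T"
  obtains R where "R \<in> bimodule_maps M N" "\<And>y. T (R y) = y"
proof -
  have hm: "hilbert_module M" "hilbert_module N"
    using M N by (simp_all add: hilbert_bimodule_def)
  interpret M: hilbert_module M by (rule hm)
  interpret N: hilbert_module N by (rule hm)
  have T': "T \<in> adjointable_maps N M" using T by (simp add: bimodule_maps_def)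
  then obtain S where adj: "is_adjoint N M T S" by (auto simp: adjointable_maps_def)
  note adj' = is_adjoint_sym[OF hm(2,1) adj]
  have S: "S \<in> bimodule_maps M N" by (rule adjoint_in_bimodule_maps[OF N M T(1) adj])
  obtain d where d: "d > 0" "\<And>y. d * norm y \<le> norm (S y)"
    using adjoint_bounded_below_if_surj[OF hm T' T(2) adj] by blast
  define P where "P = T \<circ> S"
  have P: "P \<in> bimodule_maps M M" unfolding P_def by (rule bimodule_maps_comp[OF S T(1)])
  have adjP: "is_adjoint M M P P" using adj adj' by (simp add: P_def is_adjoint_def)
  have form: "d\<^sup>2 * (norm y)\<^sup>2 \<le> norm (ip M (P y) y)" for y
  proof -
    have "ip M (P y) y = ip N (S y) (S y)" using adj by (simp add: P_def is_adjoint_def)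
    then show ?thesis
      using power_mono[OF d(2)[of y], of 2] d(1) by (simp add: N.norm_ip_self power_mult_distrib)
  qed
  have surj: "surj P"
    by (rule surj_if_self_adjoint_bounded_below[OF hm(1) _ adjP _ form])
      (use P d in \<open>auto simp: bimodule_maps_def\<close>)
  \<comment> \<open>The lower bound on the form becomes one on the operator by
    \<open>norm_ip_le\<close>, at the cost of its factor 4.\<close>
  have "d\<^sup>2 / 4 * norm y \<le> norm (P y)" for y
  proof (cases "y = 0")
    case False
    have "d\<^sup>2 * norm y * norm y \<le> 4 * norm (P y) * norm y"
      using order_trans[OF form M.norm_ip_le] by (simp add: power2_eq_square mult_ac)
    then show ?thesis using False by simp
  qed simp
  then have "inv P \<in> bimodule_maps M M"
    using inv_in_bimodule_maps[OF P surj adjP, of "d\<^sup>2 / 4"] d by simp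
  then have "S \<circ> inv P \<in> bimodule_maps M N" by (rule bimodule_maps_comp[OF _ S])
  moreover have "T ((S \<circ> inv P) y) = y" for y using surj_f_inv_f[OF surj, of y] by (simp add: P_def)
  ultimately show ?thesis by (rule that)
qed

section \<open>Projectivity\<close>

text \<open>The conditions on the module and on the representation see the record only through
  \<open>lact\<close> and \<open>ip\<close>, which adding the right action leaves unchanged.\<close>

lemma hilbert_bimodule_with_right_action:
  assumes "hilbert_module F" "star_representation F \<pi>"
  shows "hilbert_bimodule (with_right_action F \<pi>)"
proof -
  have eq: "lact (with_right_action F \<pi>) = lact F" "ip (with_right_action F \<pi>) = ip F"
    by (simp_all add: with_right_action_def)
  have "hilbert_module (with_right_action F \<pi>)"
    using assms(1) by (simp add: hilbert_module_def eq)
  moreover have "star_representation (with_right_action F \<pi>) \<pi>"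
    using assms(2) unfolding star_representation_def adjointable_maps_def is_adjoint_def eq .
  ultimately show ?thesis by (simp add: hilbert_bimodule_def) (simp add: with_right_action_def)
qed

theorem theorem4p1:
  fixes F :: "('a::cstar_algebra, 'f::complex_banach) hilbert_module"
    and \<pi> :: "'b::cstar_algebra \<Rightarrow> 'f \<Rightarrow> 'f"
  assumes "hilbert_module F"
    and "star_representation F \<pi>"
  shows "projective_object TYPE('m::complex_banach) TYPE('n::complex_banach)
           (with_right_action F \<pi>)"
  unfolding projective_object_def
proof (intro conjI allI impI ballI)
  show "hilbert_bimodule (with_right_action F \<pi>)"
    using assms by (rule hilbert_bimodule_with_right_action)
next
  fix M :: "('a, 'b, 'm) hilbert_bimodule" and N :: "('a, 'b, 'n) hilbert_bimodule" and T \<phi>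
  assume M: "hilbert_bimodule M" and N: "hilbert_bimodule N" and T: "T \<in> bimodule_maps N M" "surj T"
    and \<phi>: "\<phi> \<in> bimodule_maps (with_right_action F \<pi>) M"
  obtain R where R: "R \<in> bimodule_maps M N" "\<And>y. T (R y) = y"
    using surj_bimodule_map_right_inverse[OF M N T] by blast
  show "\<exists>\<psi>\<in>bimodule_maps (with_right_action F \<pi>) N. T \<circ> \<psi> = \<phi>"
  proof (rule bexI)
    show "R \<circ> \<phi> \<in> bimodule_maps (with_right_action F \<pi>) N" by (rule bimodule_maps_comp[OF \<phi> R(1)])
    show "T \<circ> (R \<circ> \<phi>) = \<phi>" using R(2) by (simp add: fun_eq_iff)
  qed
qed

end
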